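(* Let $\alpha$ be an umbra, let $n$ be a positive integer and let $i$ be a positive integer with $i\le n$. Then $$(\chi\boldsymbol{.}\alpha)^i\simeq\sum_{\lambda\vdash i}\frac{(\chi\boldsymbol{.}\chi)^{\nu_\lambda}}{(n)_{\nu_\lambda}}\,d_\lambda\sum_{\pi\in\Pi_{\nu_\lambda}}(\chi\boldsymbol{.}\chi)^{\boldsymbol{.}\pi}\,(n\boldsymbol{.}\alpha)_{S_\pi},$$ where $\lambda=(1^{r_1},2^{r_2},\ldots)$ runs over all partitions of the integer $i$ and $S_\pi$ is the subdivision of the multiset $P_\lambda=\{\alpha^{(r_1)},(\alpha^2)^{(r_2)},\ldots\}$ corresponding to the partition $\pi\in\Pi_{\nu_\lambda}$.
   Context: Umbral calculus: $K$ is a field of characteristic zero, $A$ a set of symbols called umbrae, $E:K[A]\to K$ a linear functional with $E[1]=1$ and $E[\alpha^i\beta^j\cdots\gamma^k]=E[\alpha^i]E[\beta^j]\cdots E[\gamma^k]$ for distinct umbrae. The moments of $\alpha$ are $a_j=E[\alpha^j]$. For umbral polynomials, $p\simeq q$ means $E[p]=E[q]$; $p,q$ are uncorrelated if no umbra occurs in both; $p\equiv q$ (similar) means $E[p^j]=E[q^j]$ for all $j\ge0$. The alphabet is saturated: for every sequence $1,a_1,a_2,\dots$ there are infinitely many umbrae with these moments, and auxiliary umbrae are treated as elements of $A$. Partitions of integers: for $\lambda=(1^{r_1},2^{r_2},\ldots)\vdash i$ ($r_j$ parts equal to $j$), $\nu_\lambda=r_1+r_2+\cdots$ and $d_\lambda=\frac{i!}{r_1!r_2!\cdots(1!)^{r_1}(2!)^{r_2}\cdots}$.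 Also $(x)_m=x(x-1)\cdots(x-m+1)$. $\Pi_k$ is the set of partitions of $[k]=\{1,\dots,k\}$. The singleton umbra $\chi$ has $E[\chi]=1$ and $E[\chi^j]=0$ for $j\ge2$. For umbrae $\gamma,\alpha$, the dot product $\gamma\boldsymbol{.}\alpha$ is an umbra with $E[(\gamma\boldsymbol{.}\alpha)^i]=\sum_{\lambda\vdash i}E[(\gamma)_{\nu_\lambda}]\,d_\lambda\,a_1^{r_1}a_2^{r_2}\cdots$. In particular $E[(\chi\boldsymbol{.}\alpha)^i]=\sum_{\lambda\vdash i}(-1)^{\nu_\lambda-1}(\nu_\lambda-1)!\,d_\lambda a_1^{r_1}a_2^{r_2}\cdots$ is the $i$th cumulant of $\alpha$, and $E[(\chi\boldsymbol{.}\chi)^k]=(-1)^{k-1}(k-1)!$ for $k\ge1$. Power sums: fix uncorrelated umbrae $\alpha_1,\dots,\alpha_n$ similar to $\alpha$; $n\boldsymbol{.}\alpha^j$ denotes $\alpha_1^j+\cdots+\alpha_n^j$ (the same $\alpha_1,\dots,\alpha_n$ for all $j$). $(\chi\boldsymbol{.}\chi)^{\boldsymbol{.}\pi}$ denotes a product, over the blocks $B$ of $\pi$, of the $|B|$th powers of uncorrelated umbrae similar to $\chi\boldsymbol{.}\chi$, so $E[(\chi\boldsymbol{.}\chi)^{\boldsymbol{.}\pi}]=\prod_{B\in\pi}(-1)^{|B|-1}(|B|-1)!$. The factors $(\chi\boldsymbol{.}\chi)^{\nu_\lambda}$, $(\chi\boldsymbol{.}\chi)^{\boldsymbol{.}\pi}$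 and $(n\boldsymbol{.}\alpha)_{S_\pi}$ are mutually uncorrelated. Subdivisions: $\mu^{(f)}$ in a multiset means $\mu$ with multiplicity $f$. Given a multiset $M$ of length $k$ (number of elements counted with multiplicity), fix $s:[k]\to M$ hitting each element as many times as its multiplicity. For $\pi\in\Pi_k$ the corresponding subdivision $S_\pi$ is the multiset of the submultisets $\{s(j):j\in B\}$, $B\in\pi$, and $(n\boldsymbol{.}\alpha)_{S_\pi}=\prod_{B\in\pi}n\boldsymbol{.}\bigl(\prod_{j\in B}s(j)\bigr)$. For $M=P_\lambda$ each $s(j)$ is a power of $\alpha$, so each factor is a power sum $n\boldsymbol{.}\alpha^{m}$. *)

theory Defs
  imports Main "HOL-Library.Poly_Mapping" "HOL-Library.Multiset" "HOL-Library.Disjoint_Sets"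
begin

text \<open>
  The alphabet is the type \<open>'u\<close>. A monomial is a finitely supported map from umbrae to
  exponents, and a polynomial in \<open>K[A]\<close> is a finitely supported map from monomials to
  coefficients; multiplication is the convolution product of \<^theory>\<open>HOL-Library.Poly_Mapping\<close>.
\<close>

type_synonym ('u, 'k) umbral_poly = "('u \<Rightarrow>\<^sub>0 nat) \<Rightarrow>\<^sub>0 'k"

definition scalar :: "'k::field_char_0 \<Rightarrow> ('u, 'k) umbral_poly" where
  "scalar c = Poly_Mapping.single 0 c"

definition umbra :: "'u \<Rightarrow> ('u, 'k::field_char_0) umbral_poly" where
  "umbra u = Poly_Mapping.single (Poly_Mapping.single u 1) 1"

definition umbrae :: "('u, 'k::field_char_0) umbral_poly \<Rightarrow> 'u set" where
  "umbrae p = (\<Union>m\<in>Poly_Mapping.keys p. Poly_Mapping.keys m)"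

lemma umbrae_umbra: "umbrae (umbra u :: ('u, 'k::field_char_0) umbral_poly) = {u}"
  by (simp add: umbrae_def umbra_def)

locale umbral_calculus =
  fixes E :: "('u, 'k::field_char_0) umbral_poly \<Rightarrow> 'k"
  assumes E_add: "E (p + q) = E p + E q"
    and E_scalar: "E (scalar c * p) = c * E p"
    and E_one: "E 1 = 1"
    and E_distinct_umbrae:
      "finite U \<Longrightarrow> E (\<Prod>u\<in>U. umbra u ^ e u) = (\<Prod>u\<in>U. E (umbra u ^ e u))"
    and saturated: "a 0 = 1 \<Longrightarrow> infinite {u. \<forall>j. E (umbra u ^ j) = a j}"

definition umbral_equiv ::
  "(('u, 'k::field_char_0) umbral_poly \<Rightarrow> 'k) \<Rightarrow> ('u, 'k) umbral_poly \<Rightarrow> ('u, 'k) umbral_poly \<Rightarrow> bool" where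
  "umbral_equiv E p q \<longleftrightarrow> E p = E q"

definition similar ::
  "(('u, 'k::field_char_0) umbral_poly \<Rightarrow> 'k) \<Rightarrow> ('u, 'k) umbral_poly \<Rightarrow> ('u, 'k) umbral_poly \<Rightarrow> bool" where
  "similar E p q \<longleftrightarrow> (\<forall>j. E (p ^ j) = E (q ^ j))"

definition uncorrelated :: "('u, 'k::field_char_0) umbral_poly \<Rightarrow> ('u, 'k) umbral_poly \<Rightarrow> bool" where
  "uncorrelated p q \<longleftrightarrow> umbrae p \<inter> umbrae q = {}"

definition uncorrelated_copies ::
  "(('u, 'k::field_char_0) umbral_poly \<Rightarrow> 'k) \<Rightarrow> 'u \<Rightarrow> 'i set \<Rightarrow> ('i \<Rightarrow> 'u) \<Rightarrow> bool" where
  "uncorrelated_copies E x I \<beta> \<longleftrightarrow>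
     (\<forall>a\<in>I. similar E (umbra (\<beta> a)) (umbra x)) \<and>
     (\<forall>a\<in>I. \<forall>b\<in>I. a \<noteq> b \<longrightarrow>
        uncorrelated (umbra (\<beta> a) :: ('u, 'k) umbral_poly) (umbra (\<beta> b)))"

text \<open>
  An integer partition is the multiset \<open>\<lambda>\<close> of its (positive) parts, so that
  \<open>\<nu>\<^sub>\<lambda> = size \<lambda>\<close> and \<open>r\<^sub>j = count \<lambda> j\<close>.
\<close>

definition integer_partitions :: "nat \<Rightarrow> nat multiset set" where
  "integer_partitions i = {l. \<Sum>\<^sub># l = i \<and> 0 \<notin># l}"

lemma finite_integer_partitions: "finite (integer_partitions i)"
proof (rule finite_subset)
  show "integer_partitions i \<subseteq> mset ` {xs. set xs \<subseteq> {..i} \<and> length xs \<le> i}"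
  proof
    fix l assume l: "l \<in> integer_partitions i"
    obtain xs where xs: "l = mset xs" by (metis ex_mset)
    have "length ys \<le> sum_list ys" if "0 \<notin> set ys" for ys :: "nat list"
      using that by (induction ys) auto
    moreover have "sum_list xs = i" "0 \<notin> set xs"
      using l by (auto simp: integer_partitions_def xs sum_mset_sum_list)
    ultimately have "xs \<in> {xs. set xs \<subseteq> {..i} \<and> length xs \<le> i}"
      using member_le_sum_list[of _ xs] by force
    then show "l \<in> mset ` {xs. set xs \<subseteq> {..i} \<and> length xs \<le> i}"
      using xs by blast
  qed
  show "finite (mset ` {xs. set xs \<subseteq> {..i} \<and> length xs \<le> i})"
    by (intro finite_imageI finite_lists_length_le) simp
qed

definition d_coeff :: "nat multiset \<Rightarrow> 'k::field_char_0" where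
  "d_coeff l = fact (\<Sum>\<^sub># l) / (\<Prod>j\<in>set_mset l. fact (count l j) * fact j ^ count l j)"

definition falling :: "'r::comm_ring_1 \<Rightarrow> nat \<Rightarrow> 'r" where
  "falling x m = (\<Prod>j<m. x - of_nat j)"

definition is_singleton_umbra :: "(('u, 'k::field_char_0) umbral_poly \<Rightarrow> 'k) \<Rightarrow> 'u \<Rightarrow> bool" where
  "is_singleton_umbra E \<chi> \<longleftrightarrow> E (umbra \<chi>) = 1 \<and> (\<forall>j\<ge>2. E (umbra \<chi> ^ j) = 0)"

text \<open>
  A dot product is determined only up to similarity, so it is treated as a relation:
  \<open>is_dot_product E \<gamma> \<alpha> \<delta>\<close> says that \<open>\<delta>\<close> is an umbra denoted by \<open>\<gamma>.\<alpha>\<close>.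
\<close>

definition is_dot_product ::
  "(('u, 'k::field_char_0) umbral_poly \<Rightarrow> 'k) \<Rightarrow> 'u \<Rightarrow> 'u \<Rightarrow> 'u \<Rightarrow> bool" where
  "is_dot_product E \<gamma> \<alpha> \<delta> \<longleftrightarrow>
     (\<forall>i. E (umbra \<delta> ^ i) =
        (\<Sum>l\<in>integer_partitions i. E (falling (umbra \<gamma>) (size l)) * d_coeff l *
           (\<Prod>j\<in>set_mset l. E (umbra \<alpha> ^ j) ^ count l j)))"

text \<open>
  \<open>is_dot_power E x \<pi> q\<close> says that \<open>q\<close> is a polynomial denoted by \<open>x\<^sup>.\<^sup>\<pi>\<close>.
\<close>

definition is_dot_power ::
  "(('u, 'k::field_char_0) umbral_poly \<Rightarrow> 'k) \<Rightarrow> 'u \<Rightarrow> nat set set \<Rightarrow> ('u, 'k) umbral_poly \<Rightarrow> bool" where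
  "is_dot_power E x \<pi> q \<longleftrightarrow>
     (\<exists>\<beta>. uncorrelated_copies E x \<pi> \<beta> \<and> q = (\<Prod>B\<in>\<pi>. umbra (\<beta> B) ^ card B))"

definition rename_umbra :: "'u \<Rightarrow> 'u \<Rightarrow> ('u, 'k::field_char_0) umbral_poly \<Rightarrow> ('u, 'k) umbral_poly" where
  "rename_umbra \<alpha> \<beta> p =
     (\<Sum>m\<in>Poly_Mapping.keys p. scalar (Poly_Mapping.lookup p m) *
        (\<Prod>u\<in>Poly_Mapping.keys m. umbra (if u = \<alpha> then \<beta> else u) ^ Poly_Mapping.lookup m u))"

text \<open>
  \<open>n.p = p(\<alpha>\<^sub>1) + \<dots> + p(\<alpha>\<^sub>n)\<close> for \<open>p \<in> K[\<alpha>]\<close>; the copies \<open>\<alpha>\<^sub>1, \<dots>, \<alpha>\<^sub>n\<close> are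
  the values of \<open>\<alpha>s\<close> on \<open>{1..n}\<close>.
\<close>

definition power_sum ::
  "'u \<Rightarrow> (nat \<Rightarrow> 'u) \<Rightarrow> nat \<Rightarrow> ('u, 'k::field_char_0) umbral_poly \<Rightarrow> ('u, 'k) umbral_poly" where
  "power_sum \<alpha> \<alpha>s n p = (\<Sum>k=1..n. rename_umbra \<alpha> (\<alpha>s k) p)"

lemma power_sum_power:
  "power_sum \<alpha> \<alpha>s n (umbra \<alpha> ^ j :: ('u, 'k::field_char_0) umbral_poly) = (\<Sum>k=1..n. umbra (\<alpha>s k) ^ j)"
proof -
  have "(umbra \<alpha> ^ j :: ('u, 'k) umbral_poly) = Poly_Mapping.single (Poly_Mapping.single \<alpha> j) 1"
    by (induction j) (simp_all add: umbra_def mult_single flip: single_add)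
  moreover have "(scalar 1 :: ('u, 'k) umbral_poly) = 1"
    by (simp add: scalar_def)
  ultimately show ?thesis
    by (simp add: power_sum_def rename_umbra_def)
qed

definition P_multiset :: "'u \<Rightarrow> nat multiset \<Rightarrow> ('u, 'k::field_char_0) umbral_poly multiset" where
  "P_multiset \<alpha> l = image_mset (\<lambda>j. umbra \<alpha> ^ j) l"

text \<open>
  \<open>s\<close> lists \<open>M\<close>, hitting each element as many times as its multiplicity.
\<close>

definition enumerates :: "(nat \<Rightarrow> 'x) \<Rightarrow> 'x multiset \<Rightarrow> bool" where
  "enumerates s M \<longleftrightarrow> image_mset s (mset_set {1..size M}) = M"

definition subdivision :: "(nat \<Rightarrow> 'x) \<Rightarrow> nat set set \<Rightarrow> 'x multiset multiset" where
  "subdivision s \<pi> = image_mset (\<lambda>B. image_mset s (mset_set B)) (mset_set \<pi>)"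

definition power_sum_subdivision ::
  "'u \<Rightarrow> (nat \<Rightarrow> 'u) \<Rightarrow> nat \<Rightarrow> ('u, 'k::field_char_0) umbral_poly multiset multiset
   \<Rightarrow> ('u, 'k) umbral_poly" where
  "power_sum_subdivision \<alpha> \<alpha>s n S = (\<Prod>T\<in>#S. power_sum \<alpha> \<alpha>s n (\<Prod>\<^sub># T))"

end

theory Submission
  imports Defs
begin

text \<open>
  Fix a partition \<open>\<lambda>\<close> with \<open>k\<close> parts \<open>e\<^sub>1, \<dots>, e\<^sub>k\<close> and write \<open>a\<^sub>m = E[\<alpha>\<^sup>m]\<close> and
  \<open>c\<^sub>m = (-1)\<^sup>m\<^sup>-\<^sup>1 (m-1)!\<close>.
  These numbers are at once the moments of \<open>\<chi>.\<chi>\<close>, the values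
  \<open>E[(\<chi>)\<^sub>m]\<close> for \<open>m \<ge> 1\<close>, and the Moebius coefficients of the partition lattice. The last
  property is what makes the inner sum collapse: in the polynomial ring itself,
  the sum over \<open>\<pi> \<in> \<Pi>\<^sub>k\<close> of \<open>\<Prod>\<^sub>B c\<^bsub>|B|\<^esub> \<Sum>\<^sub>v \<Prod>\<^bsub>j\<in>B\<^esub> \<alpha>\<^sub>v\<^bsup>e\<^sub>j\<^esup>\<close> equals the sum of
  \<open>\<Prod>\<^sub>j \<alpha>\<^bsub>f j\<^esub>\<^bsup>e\<^sub>j\<^esup>\<close> over the injections \<open>f\<close> from \<open>[k]\<close> to \<open>[n]\<close>, because inclusion and exclusion
  cancel every term in which two parts use the same copy of \<open>\<alpha>\<close>
  (\<open>sum_partitions_block_sums_eq_injection_sum\<close>).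

  Each surviving term is a product of powers of distinct copies, so its evaluation is
  \<open>a\<^bsub>e\<^sub>1\<^esub> \<cdots> a\<^bsub>e\<^sub>k\<^esub>\<close>, and there are \<open>(n)\<^sub>k\<close> of them. As \<open>k \<le> i \<le> n\<close>, the factor \<open>(n)\<^sub>k\<close> is nonzero
  and cancels against the denominator. What remains of the summand at \<open>\<lambda>\<close> is
  \<open>E[(\<chi>.\<chi>)\<^sup>k] d\<^sub>\<lambda> \<Prod>\<^sub>j a\<^bsub>e\<^sub>j\<^esub>\<close>, which by \<open>E_chi_dot_chi_power\<close> is the
  \<open>\<lambda>\<close>-term in the moment formula of the dot product \<open>\<chi>.\<alpha>\<close>. The passage
  between products and evaluations rests on \<open>E_mult_uncorrelated\<close>, which extends the
  multiplicativity of \<open>E\<close> from monomials to arbitrary uncorrelated polynomials.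
\<close>

section \<open>Partition sums with Moebius weights\<close>

text \<open>
  A partition of \<open>insert a K\<close> arises from exactly one partition \<open>\<pi>\<close> of \<open>K\<close>, either by adding \<open>a\<close>
  to a block \<open>B\<close> of \<open>\<pi>\<close> or as a singleton block. Letting \<open>B\<close> also be the empty set, which is never
  a block, treats both cases by one formula.
\<close>

lemma sum_over_partitions_insert:
  fixes F :: "'a set set \<Rightarrow> 'b::comm_monoid_add"
  assumes "finite K" and "a \<notin> K"
  shows "(\<Sum>\<rho> | partition_on (insert a K) \<rho>. F \<rho>) =
    (\<Sum>\<pi> | partition_on K \<pi>. \<Sum>B\<in>insert {} \<pi>. F (insert (insert a B) (\<pi> - {B})))"
proof -
  \<comment> \<open>The block containing \<open>a\<close>; deleting \<open>a\<close> from it inverts the construction.\<close>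
  define blk where "blk \<rho> = (THE C. C \<in> \<rho> \<and> a \<in> C)" for \<rho> :: "'a set set"
  have blk: "blk \<rho> = C" if "partition_on D \<rho>" "C \<in> \<rho>" "a \<in> C" for \<rho> C D
    unfolding blk_def using that
    by (intro the_equality) (auto simp: partition_on_def disjoint_def)
  have blk_ex: "blk \<rho> \<in> \<rho>" "a \<in> blk \<rho>" if "partition_on (insert a K) \<rho>" for \<rho>
  proof -
    have "a \<in> \<Union>\<rho>"
      using partition_onD1[OF that] by blast
    then obtain C where C: "C \<in> \<rho>" "a \<in> C"
      by blast
    with blk[OF that] show "blk \<rho> \<in> \<rho>" "a \<in> blk \<rho>"
      by auto
  qed
  have a_notin: "a \<notin> C" if "partition_on K \<pi>" "C \<in> insert {} \<pi>" for \<pi> C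
    using assms(2) that by (auto simp: partition_on_def)
  have up: "partition_on (insert a K) (insert (insert a B) (\<pi> - {B}))"
    if \<pi>: "partition_on K \<pi>" and B: "B \<in> insert {} \<pi>" for \<pi> B
  proof -
    have U: "\<Union>\<pi> = K" and dj: "disjoint \<pi>" and ne: "{} \<notin> \<pi>"
      using \<pi> by (auto simp: partition_on_def)
    have dB: "B \<inter> C = {}" if "C \<in> \<pi> - {B}" for C
      using B dj that by (auto simp: disjoint_def)
    have "\<Union>(\<pi> - {B}) \<union> B = K"
      using U B by auto
    then have "\<Union>(insert (insert a B) (\<pi> - {B})) = insert a K"
      by auto
    moreover have "disjoint (insert (insert a B) (\<pi> - {B}))"
      using dj dB a_notin[OF \<pi>] unfolding disjoint_def by (auto; blast)
    ultimately show ?thesis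
      using ne by (auto simp: partition_on_def)
  qed
  have down: "partition_on K ((\<rho> - {blk \<rho>}) \<union> ({blk \<rho> - {a}} - {{}}))"
    if \<rho>: "partition_on (insert a K) \<rho>" for \<rho>
  proof -
    have U: "\<Union>\<rho> = insert a K" and dj: "disjoint \<rho>" and ne: "{} \<notin> \<rho>"
      using \<rho> by (auto simp: partition_on_def)
    have other: "C \<inter> blk \<rho> = {}" if "C \<in> \<rho> - {blk \<rho>}" for C
      using that dj blk_ex[OF \<rho>] by (auto simp: disjoint_def)
    have "\<Union>((\<rho> - {blk \<rho>}) \<union> ({blk \<rho> - {a}} - {{}})) = \<Union>(\<rho> - {blk \<rho>}) \<union> (blk \<rho> - {a})"
      by auto
    also have "\<dots> = (\<Union>(\<rho> - {blk \<rho>}) \<union> blk \<rho>) - {a}"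
      using other blk_ex(2)[OF \<rho>] by fastforce
    also have "\<Union>(\<rho> - {blk \<rho>}) \<union> blk \<rho> = \<Union>\<rho>"
      using blk_ex(1)[OF \<rho>] by auto
    also have "\<Union>\<rho> - {a} = K"
      using U assms(2) by auto
    finally have "\<Union>((\<rho> - {blk \<rho>}) \<union> ({blk \<rho> - {a}} - {{}})) = K" .
    moreover have "disjoint ((\<rho> - {blk \<rho>}) \<union> ({blk \<rho> - {a}} - {{}}))"
      using dj other unfolding disjoint_def by (auto; blast)
    ultimately show ?thesis
      using ne by (auto simp: partition_on_def)
  qed
  have rest_notin: "blk \<rho> - {a} \<notin> \<rho>" if \<rho>: "partition_on (insert a K) \<rho>" for \<rho>
  proof
    assume *: "blk \<rho> - {a} \<in> \<rho>"
    have "blk \<rho> - {a} \<noteq> blk \<rho>"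
      using blk_ex(2)[OF \<rho>] by blast
    then have "(blk \<rho> - {a}) \<inter> blk \<rho> = {}"
      using disjointD[OF partition_onD2[OF \<rho>] * blk_ex(1)[OF \<rho>]] by blast
    then have "blk \<rho> - {a} = {}"
      by blast
    then show False
      using * partition_onD3[OF \<rho>] by metis
  qed
  have "(\<Sum>\<rho> | partition_on (insert a K) \<rho>. F \<rho>) =
    (\<Sum>(\<pi>, B)\<in>Sigma {\<pi>. partition_on K \<pi>} (insert {}). F (insert (insert a B) (\<pi> - {B})))"
  proof (rule sum.reindex_bij_witness
      [where i = "\<lambda>(\<pi>, B). insert (insert a B) (\<pi> - {B})"
         and j = "\<lambda>\<rho>. ((\<rho> - {blk \<rho>}) \<union> ({blk \<rho> - {a}} - {{}}), blk \<rho> - {a})"], goal_cases)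
    case (1 \<rho>)
    then have \<rho>: "partition_on (insert a K) \<rho>" by simp
    note rest_notin[OF \<rho>]
    then show ?case
      using blk_ex[OF \<rho>] by (auto simp: insert_absorb)
  next
    case (2 \<rho>)
    then show ?case using down by auto
  next
    case (3 b)
    obtain \<pi> B where b: "b = (\<pi>, B)" by force
    have \<pi>: "partition_on K \<pi>" and B: "B \<in> insert {} \<pi>"
      using 3 b by auto
    have bl: "blk (insert (insert a B) (\<pi> - {B})) = insert a B"
      by (rule blk[OF up[OF \<pi> B]]) auto
    have "insert a B \<notin> \<pi>" "a \<notin> B" "{} \<notin> \<pi>"
      using a_notin[OF \<pi>] B partition_onD3[OF \<pi>] by auto
    then show ?case
      using B by (auto simp: b bl)
  next
    case (4 b)
    then show ?case using up by auto
  next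
    case (5 \<rho>)
    then have \<rho>: "partition_on (insert a K) \<rho>" by simp
    note rest_notin[OF \<rho>]
    then have "insert (insert a (blk \<rho> - {a}))
        ((\<rho> - {blk \<rho>}) \<union> ({blk \<rho> - {a}} - {{}}) - {blk \<rho> - {a}}) = \<rho>"
      using blk_ex[OF \<rho>] by (auto simp: insert_absorb)
    then show ?case by simp
  qed
  also have "\<dots> = (\<Sum>\<pi> | partition_on K \<pi>. \<Sum>B\<in>insert {} \<pi>. F (insert (insert a B) (\<pi> - {B})))"
    using assms(1) finite_elements[OF assms(1)]
    by (subst sum.Sigma) (auto simp: finitely_many_partition_on)
  finally show ?thesis .
qed

text \<open>
  When \<open>x j v\<close> is the power \<open>v\<^bsup>e\<^sub>j\<^esup>\<close> of a variable, this is the augmented monomial symmetric function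
  of the exponents \<open>e\<close>, and \<open>block_sum\<close> below is the power sum attached to a block.
\<close>

definition injection_sum :: "('a \<Rightarrow> 'v \<Rightarrow> 'r::comm_ring_1) \<Rightarrow> 'a set \<Rightarrow> 'v set \<Rightarrow> 'r" where
  "injection_sum x K V = (\<Sum>f | f \<in> K \<rightarrow>\<^sub>E V \<and> inj_on f K. \<Prod>j\<in>K. x j (f j))"

definition block_sum :: "('a \<Rightarrow> 'v \<Rightarrow> 'r::comm_ring_1) \<Rightarrow> 'v set \<Rightarrow> 'a set \<Rightarrow> 'r" where
  "block_sum x V B = (\<Sum>v\<in>V. \<Prod>j\<in>B. x j v)"

text \<open>
  An injection on \<open>K\<close> extends to \<open>a\<close> by any value outside its image. Summing over all values instead
  overcounts by the cases where \<open>a\<close> gets the value of some \<open>j \<in> K\<close>, and in such a case the factor of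
  \<open>a\<close> can be absorbed into the factor of \<open>j\<close>.
\<close>

lemma injection_sum_insert:
  fixes x :: "'a \<Rightarrow> 'v \<Rightarrow> 'r::comm_ring_1"
  assumes "finite K" "finite V" "a \<notin> K"
  shows "injection_sum x (insert a K) V =
    injection_sum x K V * (\<Sum>v\<in>V. x a v) -
    (\<Sum>j\<in>K. injection_sum (x(j := \<lambda>v. x j v * x a v)) K V)"
proof -
  define I where "I = {f. f \<in> K \<rightarrow>\<^sub>E V \<and> inj_on f K}"
  have finI: "finite I"
    unfolding I_def by (rule finite_subset[of _ "K \<rightarrow>\<^sub>E V"]) (auto intro: finite_PiE assms)
  have "injection_sum x (insert a K) V =
    (\<Sum>(f, v)\<in>Sigma I (\<lambda>f. V - f ` K). (\<Prod>j\<in>K. x j (f j)) * x a v)"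
    unfolding injection_sum_def
  proof (rule sum.reindex_bij_witness[where i = "\<lambda>(f, v). f(a := v)"
        and j = "\<lambda>f. (restrict f K, f a)"], goal_cases)
    case (1 f)
    then show ?case
      by (auto simp: fun_eq_iff PiE_def extensional_def)
  next
    case (2 f)
    then show ?case using assms(3)
      by (auto simp: I_def inj_on_def restrict_def)
  next
    case (3 b)
    then show ?case using assms(3)
      by (auto simp: I_def fun_eq_iff PiE_def extensional_def)
  next
    case (4 b)
    then show ?case using assms(3)
      by (auto simp: I_def PiE_def extensional_def Pi_def intro!: inj_on_fun_updI split: if_splits)
  next
    case (5 f)
    have "(\<Prod>j\<in>K. x j (restrict f K j)) = (\<Prod>j\<in>K. x j (f j))"
      by (rule prod.cong) auto
    then show ?case using assms by (simp add: mult.commute)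
  qed
  also have "\<dots> = (\<Sum>f\<in>I. \<Sum>v\<in>V - f ` K. (\<Prod>j\<in>K. x j (f j)) * x a v)"
    by (subst sum.Sigma) (use finI assms in auto)
  also have "\<dots> = (\<Sum>f\<in>I. (\<Prod>j\<in>K. x j (f j)) * (\<Sum>v\<in>V. x a v) -
      (\<Sum>j\<in>K. \<Prod>l\<in>K. (x(j := \<lambda>v. x j v * x a v)) l (f l)))"
  proof (rule sum.cong[OF refl])
    fix f assume f: "f \<in> I"
    have "(\<Sum>v\<in>V - f ` K. x a v) = (\<Sum>v\<in>V. x a v) - (\<Sum>v\<in>f ` K. x a v)"
      by (rule sum_diff) (use f assms in \<open>auto simp: I_def\<close>)
    also have "(\<Sum>v\<in>f ` K. x a v) = (\<Sum>j\<in>K. x a (f j))"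
      by (subst sum.reindex) (use f in \<open>auto simp: I_def\<close>)
    finally have *: "(\<Sum>v\<in>V - f ` K. x a v) = (\<Sum>v\<in>V. x a v) - (\<Sum>j\<in>K. x a (f j))" .
    have "(\<Prod>l\<in>K. (x(j := \<lambda>v. x j v * x a v)) l (f l)) = (\<Prod>l\<in>K. x l (f l)) * x a (f j)"
      if "j \<in> K" for j
    proof -
      have "(\<Prod>l\<in>K - {j}. (x(j := \<lambda>v. x j v * x a v)) l (f l)) = (\<Prod>l\<in>K - {j}. x l (f l))"
        by (rule prod.cong) auto
      then show ?thesis
        using that assms(1) by (simp add: prod.remove[of K j] mult_ac)
    qed
    then have **: "(\<Sum>j\<in>K. \<Prod>l\<in>K. (x(j := \<lambda>v. x j v * x a v)) l (f l)) =
        (\<Prod>l\<in>K. x l (f l)) * (\<Sum>j\<in>K. x a (f j))"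
      by (simp add: sum_distrib_left)
    show "(\<Sum>v\<in>V - f ` K. (\<Prod>j\<in>K. x j (f j)) * x a v) =
        (\<Prod>j\<in>K. x j (f j)) * (\<Sum>v\<in>V. x a v) -
        (\<Sum>j\<in>K. \<Prod>l\<in>K. (x(j := \<lambda>v. x j v * x a v)) l (f l))"
      unfolding ** by (simp add: sum_distrib_left[symmetric] * right_diff_distrib)
  qed
  also have "\<dots> = injection_sum x K V * (\<Sum>v\<in>V. x a v) -
      (\<Sum>f\<in>I. \<Sum>j\<in>K. \<Prod>l\<in>K. (x(j := \<lambda>v. x j v * x a v)) l (f l))"
    by (simp add: sum_subtractf sum_distrib_right injection_sum_def I_def)
  also have "(\<Sum>f\<in>I. \<Sum>j\<in>K. \<Prod>l\<in>K. (x(j := \<lambda>v. x j v * x a v)) l (f l)) =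
      (\<Sum>j\<in>K. injection_sum (x(j := \<lambda>v. x j v * x a v)) K V)"
    unfolding injection_sum_def I_def by (rule sum.swap)
  finally show ?thesis .
qed

lemma block_sum_merge:
  assumes "finite B" "a \<notin> B"
  shows "block_sum (x(j := \<lambda>v. x j v * x a v)) V B =
    (if j \<in> B then block_sum x V (insert a B) else block_sum x V B)"
proof (cases "j \<in> B")
  case True
  have "(\<Prod>l\<in>B. (x(j := \<lambda>v. x j v * x a v)) l v) = (\<Prod>l\<in>insert a B. x l v)" for v
  proof -
    have "(\<Prod>l\<in>B - {j}. (x(j := \<lambda>v. x j v * x a v)) l v) = (\<Prod>l\<in>B - {j}. x l v)"
      by (rule prod.cong) auto
    then show ?thesis
      using True assms by (simp add: prod.remove[of B j] mult_ac)
  qed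
  with True show ?thesis by (simp add: block_sum_def)
next
  case False
  then have "(\<Prod>l\<in>B. (x(j := \<lambda>v. x j v * x a v)) l v) = (\<Prod>l\<in>B. x l v)" for v
    by (intro prod.cong) auto
  with False show ?thesis by (simp add: block_sum_def)
qed

text \<open>
  The weights \<open>w m = (-1)\<^sup>m\<^sup>-\<^sup>1 (m-1)!\<close> enter through their recurrence alone, which suits the induction:
  adding \<open>a\<close> as a singleton block multiplies the summand by the sum over all values of \<open>a\<close>, while
  adding \<open>a\<close> to a block \<open>B\<close> contributes a factor \<open>- card B\<close>, that is, one negative term for each
  \<open>j \<in> B\<close>. Over all blocks this gives one negative term for each \<open>j \<in> K\<close>, in which \<open>a\<close> is
  merged with \<open>j\<close>, exactly as in \<open>injection_sum_insert\<close>. Merging changes the family \<open>x\<close>, so the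
  induction is over all \<open>x\<close>.
\<close>

theorem sum_partitions_block_sums_eq_injection_sum:
  fixes x :: "'a \<Rightarrow> 'v \<Rightarrow> 'r::comm_ring_1" and w :: "nat \<Rightarrow> 'r"
  assumes w_1: "w 1 = 1"
    and w_Suc: "\<And>m. 1 \<le> m \<Longrightarrow> w (Suc m) = - of_nat m * w m"
    and "finite V" and "finite K"
  shows "(\<Sum>\<pi> | partition_on K \<pi>. \<Prod>B\<in>\<pi>. w (card B) * block_sum x V B) = injection_sum x K V"
  using \<open>finite K\<close>
proof (induction K arbitrary: x rule: finite_induct)
  case empty
  have "{f. f \<in> {} \<rightarrow>\<^sub>E V \<and> inj_on f {}} = {\<lambda>_. undefined}"
    by auto
  then show ?case
    by (simp add: partition_on_empty injection_sum_def)
next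
  case (insert a K)
  define G where "G y B = w (card B) * block_sum y V B" for y and B :: "'a set"
  \<comment> \<open>The recurrence of \<open>injection_sum_insert\<close> already holds for each partition of \<open>K\<close> separately.\<close>
  have step: "(\<Sum>B\<in>insert {} \<pi>. \<Prod>C\<in>insert (insert a B) (\<pi> - {B}). G x C) =
      (\<Prod>B\<in>\<pi>. G x B) * (\<Sum>v\<in>V. x a v) -
      (\<Sum>j\<in>K. \<Prod>C\<in>\<pi>. G (x(j := \<lambda>v. x j v * x a v)) C)"
    if \<pi>: "partition_on K \<pi>" for \<pi>
  proof -
    have fin: "finite \<pi>" and fin_blk: "\<And>B. B \<in> \<pi> \<Longrightarrow> finite B" and ne: "{} \<notin> \<pi>"
      and a: "\<And>B. B \<in> \<pi> \<Longrightarrow> a \<notin> B"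
      using \<pi> insert.hyps finite_elements[OF insert.hyps(1) \<pi>]
      by (auto simp: partition_on_def intro: finite_subset)
    have new_ne: "insert a B \<notin> \<pi> - {B}" for B
      using a by auto
    have "(\<Prod>C\<in>insert (insert a B) (\<pi> - {B}). G x C) =
        - (\<Sum>j\<in>B. \<Prod>C\<in>\<pi>. G (x(j := \<lambda>v. x j v * x a v)) C)" if B: "B \<in> \<pi>" for B
    proof -
      have "(\<Prod>C\<in>\<pi>. G (x(j := \<lambda>v. x j v * x a v)) C) =
          w (card B) * block_sum x V (insert a B) * (\<Prod>C\<in>\<pi> - {B}. G x C)" if j: "j \<in> B" for j
      proof -
        have "j \<notin> C" if "C \<in> \<pi> - {B}" for C
          using that j B \<pi> by (auto simp: partition_on_def disjoint_def)
        then have "(\<Prod>C\<in>\<pi> - {B}. G (x(j := \<lambda>v. x j v * x a v)) C) = (\<Prod>C\<in>\<pi> - {B}. G x C)"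
          using fin_blk a by (intro prod.cong) (auto simp: G_def block_sum_merge)
        then show ?thesis
          using B j fin fin_blk[OF B] a[OF B]
          by (simp add: prod.remove[of \<pi> B] G_def block_sum_merge)
      qed
      then have "(\<Sum>j\<in>B. \<Prod>C\<in>\<pi>. G (x(j := \<lambda>v. x j v * x a v)) C) =
          of_nat (card B) * w (card B) * block_sum x V (insert a B) * (\<Prod>C\<in>\<pi> - {B}. G x C)"
        by (simp add: mult_ac)
      moreover have "1 \<le> card B"
        using B ne fin_blk[OF B] by (metis One_nat_def Suc_leI card_gt_0_iff)
      ultimately show ?thesis
        using new_ne[of B] fin fin_blk[OF B] a[OF B] w_Suc[of "card B"]
        by (simp add: G_def)
    qed
    then have "(\<Sum>B\<in>\<pi>. \<Prod>C\<in>insert (insert a B) (\<pi> - {B}). G x C) =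
        - (\<Sum>B\<in>\<pi>. \<Sum>j\<in>B. \<Prod>C\<in>\<pi>. G (x(j := \<lambda>v. x j v * x a v)) C)"
      by (simp add: sum_negf)
    also have "\<dots> = - (\<Sum>j\<in>K. \<Prod>C\<in>\<pi>. G (x(j := \<lambda>v. x j v * x a v)) C)"
      by (subst sum.partition[OF insert.hyps(1) \<pi>]) simp
    finally have *: "(\<Sum>B\<in>\<pi>. \<Prod>C\<in>insert (insert a B) (\<pi> - {B}). G x C) =
        - (\<Sum>j\<in>K. \<Prod>C\<in>\<pi>. G (x(j := \<lambda>v. x j v * x a v)) C)" .
    have "(\<Prod>C\<in>insert (insert a {}) (\<pi> - {{}}). G x C) = (\<Prod>B\<in>\<pi>. G x B) * (\<Sum>v\<in>V. x a v)"
      using new_ne[of "{}"] ne fin w_1 by (simp add: G_def block_sum_def mult.commute)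
    then show ?thesis
      using ne fin * by simp
  qed
  have "(\<Sum>\<rho> | partition_on (insert a K) \<rho>. \<Prod>B\<in>\<rho>. G x B) =
      (\<Sum>\<pi> | partition_on K \<pi>. (\<Prod>B\<in>\<pi>. G x B) * (\<Sum>v\<in>V. x a v) -
        (\<Sum>j\<in>K. \<Prod>C\<in>\<pi>. G (x(j := \<lambda>v. x j v * x a v)) C))"
    by (subst sum_over_partitions_insert[OF insert.hyps]) (simp add: step)
  also have "\<dots> = (\<Sum>\<pi> | partition_on K \<pi>. \<Prod>B\<in>\<pi>. G x B) * (\<Sum>v\<in>V. x a v) -
      (\<Sum>j\<in>K. \<Sum>\<pi> | partition_on K \<pi>. \<Prod>C\<in>\<pi>. G (x(j := \<lambda>v. x j v * x a v)) C)"
    unfolding sum_subtractf sum_distrib_right[symmetric] by (subst sum.swap) (rule refl)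
  also have "\<dots> = injection_sum x K V * (\<Sum>v\<in>V. x a v) -
      (\<Sum>j\<in>K. injection_sum (x(j := \<lambda>v. x j v * x a v)) K V)"
    unfolding G_def insert.IH ..
  also have "\<dots> = injection_sum x (insert a K) V"
    by (rule injection_sum_insert[symmetric]) (use insert.hyps \<open>finite V\<close> in auto)
  finally show ?case
    by (simp add: G_def)
qed


section \<open>Umbral polynomials\<close>

lemma umbra_power: "(umbra u ^ j :: ('u, 'k::field_char_0) umbral_poly) =
    Poly_Mapping.single (Poly_Mapping.single u j) 1"
  by (induction j) (simp_all add: umbra_def mult_single flip: single_add)

text \<open>
  Distinct exponents give distinct polynomials, so an enumeration of \<open>P\<^sub>\<lambda>\<close> determines an enumeration
  of the parts of \<open>\<lambda>\<close>.
\<close>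

lemma umbra_power_inject:
  "(umbra u ^ i :: ('u, 'k::field_char_0) umbral_poly) = umbra u ^ j \<longleftrightarrow> i = j"
proof
  assume "(umbra u ^ i :: ('u, 'k) umbral_poly) = umbra u ^ j"
  then have "Poly_Mapping.keys (umbra u ^ i :: ('u, 'k) umbral_poly) = Poly_Mapping.keys (umbra u ^ j :: ('u, 'k) umbral_poly)"
    by simp
  then have "Poly_Mapping.single u i = Poly_Mapping.single u j"
    by (simp add: umbra_power)
  then show "i = j"
    by (metis lookup_single_eq)
qed simp

lemma poly_eq_sum_monomials:
  fixes p :: "('u, 'k::field_char_0) umbral_poly"
  shows "p = (\<Sum>m\<in>Poly_Mapping.keys p.
    scalar (Poly_Mapping.lookup p m) * (\<Prod>u\<in>Poly_Mapping.keys m. umbra u ^ Poly_Mapping.lookup m u))"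
proof -
  have m: "(\<Sum>u\<in>Poly_Mapping.keys m. Poly_Mapping.single u (Poly_Mapping.lookup m u)) = m"
    for m :: "'u \<Rightarrow>\<^sub>0 nat"
    by (rule poly_mapping_eqI)
      (auto simp: lookup_sum lookup_single when_def in_keys_iff)
  have prod_single: "finite U \<Longrightarrow> (\<Prod>u\<in>U. Poly_Mapping.single (g u) 1) =
      (Poly_Mapping.single (sum g U) 1 :: ('u, 'k) umbral_poly)" for U :: "'u set" and g
    by (induction U rule: finite_induct) (simp_all add: mult_single)
  have "(\<Prod>u\<in>Poly_Mapping.keys m. umbra u ^ Poly_Mapping.lookup m u) =
      (Poly_Mapping.single m 1 :: ('u, 'k) umbral_poly)" for m
    by (simp add: umbra_power prod_single m)
  then show ?thesis
    by (intro poly_mapping_eqI)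
      (auto simp: scalar_def mult_single lookup_sum lookup_single when_def in_keys_iff)
qed

lemma umbrae_mult: "umbrae (p * q) \<subseteq> umbrae p \<union> umbrae q"
  using keys_mult[of p q] keys_add unfolding umbrae_def by fastforce

lemma umbrae_sum: "umbrae (sum p I) \<subseteq> (\<Union>i\<in>I. umbrae (p i))"
  using keys_sum[of p I] unfolding umbrae_def by fastforce

lemma uncorrelated_sum:
  "(\<And>i. i \<in> I \<Longrightarrow> uncorrelated p (q i)) \<Longrightarrow> uncorrelated p (sum q I)"
  using umbrae_sum[of q I] by (fastforce simp: uncorrelated_def)

lemma uncorrelated_mult:
  "uncorrelated p q \<Longrightarrow> uncorrelated p r \<Longrightarrow> uncorrelated p (q * r)"
  using umbrae_mult[of q r] by (fastforce simp: uncorrelated_def)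

lemma scalar_mult: "scalar (a * b) = scalar a * scalar b"
  by (simp add: scalar_def mult_single)

lemma scalar_one: "scalar 1 = 1"
  by (simp add: scalar_def)

lemma scalar_of_nat: "scalar (of_nat m) = of_nat m"
  by (simp add: scalar_def single_of_nat)

lemma scalar_uminus: "scalar (- a) = - scalar a"
  by (simp add: scalar_def single_uminus)

lemma scalar_prod: "scalar (prod f I) = (\<Prod>i\<in>I. scalar (f i))"
  by (induction I rule: infinite_finite_induct) (simp_all add: scalar_mult scalar_one)

section \<open>Evaluation of uncorrelated products\<close>

context umbral_calculus
begin

lemma E_zero: "E 0 = 0"
  using E_add[of 0 0] by simp

lemma E_sum: "E (sum p I) = (\<Sum>i\<in>I. E (p i))"
  by (induction I rule: infinite_finite_induct) (simp_all add: E_zero E_add)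

lemma E_diff_of_nat: "E (p - of_nat m * q) = E p - of_nat m * E q"
proof -
  have "p - of_nat m * q = p + scalar (- of_nat m) * q"
    by (simp add: scalar_uminus scalar_of_nat)
  then show ?thesis
    by (simp only: E_add E_scalar) simp
qed

text \<open>
  By bilinearity this reduces to two monomials with disjoint supports; their product is again a
  product of powers of distinct umbrae, where \<open>E\<close> is multiplicative by axiom.
\<close>

theorem E_mult_uncorrelated:
  assumes "uncorrelated p q"
  shows "E (p * q) = E p * E q"
proof -
  define mon :: "('u \<Rightarrow>\<^sub>0 nat) \<Rightarrow> ('u, 'k) umbral_poly"
    where "mon m = (\<Prod>u\<in>Poly_Mapping.keys m. umbra u ^ Poly_Mapping.lookup m u)" for m
  have expand: "r = (\<Sum>m\<in>Poly_Mapping.keys r. scalar (Poly_Mapping.lookup r m) * mon m)" for r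
    unfolding mon_def by (rule poly_eq_sum_monomials)
  have E_expand: "E r = (\<Sum>m\<in>Poly_Mapping.keys r. Poly_Mapping.lookup r m * E (mon m))" for r
    by (subst expand) (simp add: E_sum E_scalar)
  have E_mon: "E (mon m * mon m') = E (mon m) * E (mon m')"
    if "m \<in> Poly_Mapping.keys p" "m' \<in> Poly_Mapping.keys q" for m m'
  proof -
    have dis: "Poly_Mapping.keys m \<inter> Poly_Mapping.keys m' = {}"
      using assms that by (auto simp: uncorrelated_def umbrae_def)
    \<comment> \<open>Disjointness allows one exponent function to serve both monomials.\<close>
    define e where "e u = Poly_Mapping.lookup m u + Poly_Mapping.lookup m' u" for u
    have zero: "Poly_Mapping.lookup m' u = 0" if "u \<in> Poly_Mapping.keys m" for u
      using dis that by (auto simp: disjoint_iff in_keys_iff)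
    have zero': "Poly_Mapping.lookup m u = 0" if "u \<in> Poly_Mapping.keys m'" for u
      using dis that by (metis disjoint_iff not_in_keys_iff_lookup_eq_zero)
    have e: "mon m = (\<Prod>u\<in>Poly_Mapping.keys m. umbra u ^ e u)"
        "mon m' = (\<Prod>u\<in>Poly_Mapping.keys m'. umbra u ^ e u)"
      unfolding mon_def e_def using zero zero' by (auto intro!: prod.cong)
    have "mon m * mon m' = (\<Prod>u\<in>Poly_Mapping.keys m \<union> Poly_Mapping.keys m'. umbra u ^ e u)"
      unfolding e by (rule prod.union_disjoint[symmetric]) (use dis in auto)
    then have "E (mon m * mon m') =
        (\<Prod>u\<in>Poly_Mapping.keys m \<union> Poly_Mapping.keys m'. E (umbra u ^ e u))"
      by (simp add: E_distinct_umbrae)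
    also have "\<dots> = E (mon m) * E (mon m')"
      unfolding e by (simp add: E_distinct_umbrae prod.union_disjoint dis)
    finally show ?thesis .
  qed
  have "p * q = (\<Sum>m\<in>Poly_Mapping.keys p. \<Sum>m'\<in>Poly_Mapping.keys q.
      scalar (Poly_Mapping.lookup p m * Poly_Mapping.lookup q m') * (mon m * mon m'))"
    by (subst expand[of p], subst expand[of q]) (simp add: sum_product scalar_mult mult_ac)
  then have "E (p * q) = (\<Sum>m\<in>Poly_Mapping.keys p. \<Sum>m'\<in>Poly_Mapping.keys q.
      Poly_Mapping.lookup p m * Poly_Mapping.lookup q m' * (E (mon m) * E (mon m')))"
    by (simp add: E_sum E_scalar E_mon)
  also have "\<dots> = E p * E q"
    unfolding E_expand[of p] E_expand[of q] by (simp add: sum_product mult_ac)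
  finally show ?thesis .
qed

lemma E_prod_umbra_powers:
  assumes "finite I" "inj_on g I"
  shows "E (\<Prod>i\<in>I. umbra (g i) ^ e i) = (\<Prod>i\<in>I. E (umbra (g i) ^ e i))"
proof -
  define e' where "e' u = e (the_inv_into I g u)" for u
  have e': "e' (g i) = e i" if "i \<in> I" for i
    using that assms(2) by (simp add: e'_def the_inv_into_f_f)
  have "E (\<Prod>i\<in>I. umbra (g i) ^ e i) = E (\<Prod>u\<in>g ` I. umbra u ^ e' u)"
    by (simp add: prod.reindex[OF assms(2)] e')
  also have "\<dots> = (\<Prod>u\<in>g ` I. E (umbra u ^ e' u))"
    by (rule E_distinct_umbrae) (simp add: assms(1))
  also have "\<dots> = (\<Prod>i\<in>I. E (umbra (g i) ^ e i))"
    by (simp add: prod.reindex[OF assms(2)] e')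
  finally show ?thesis .
qed

lemma uncorrelated_copies_inj_on: "uncorrelated_copies E x I \<beta> \<Longrightarrow> inj_on \<beta> I"
  by (rule inj_onI) (auto simp: uncorrelated_copies_def uncorrelated_def umbrae_umbra)

lemma E_prod_uncorrelated_copies:
  assumes "finite I" "inj_on f I" "f ` I \<subseteq> J" "uncorrelated_copies E x J \<beta>"
  shows "E (\<Prod>i\<in>I. umbra (\<beta> (f i)) ^ e i) = (\<Prod>i\<in>I. E (umbra x ^ e i))"
proof -
  have "inj_on (\<lambda>i. \<beta> (f i)) I"
    using comp_inj_on[OF assms(2) inj_on_subset[OF uncorrelated_copies_inj_on[OF assms(4)] assms(3)]]
    by (simp add: comp_def)
  then have "E (\<Prod>i\<in>I. umbra (\<beta> (f i)) ^ e i) = (\<Prod>i\<in>I. E (umbra (\<beta> (f i)) ^ e i))"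
    by (rule E_prod_umbra_powers[OF assms(1)])
  also have "\<dots> = (\<Prod>i\<in>I. E (umbra x ^ e i))"
    using assms(3,4) by (intro prod.cong) (auto simp: uncorrelated_copies_def similar_def)
  finally show ?thesis .
qed

lemma E_dot_power:
  assumes "finite \<pi>" "is_dot_power E x \<pi> q"
  shows "E q = (\<Prod>B\<in>\<pi>. E (umbra x ^ card B))"
  using E_prod_uncorrelated_copies[of \<pi> id \<pi> x _ card] assms
  by (auto simp: is_dot_power_def)

section \<open>The moments of \<open>\<chi>.\<chi>\<close>\<close>

text \<open>
  \<open>(\<chi>)\<^sub>m\<close> is divisible by \<open>\<chi>\<close> for \<open>m \<ge> 1\<close>, so a further factor \<open>\<chi>\<close> leaves only powers
  \<open>\<chi>\<^sup>j\<close> with \<open>j \<ge> 2\<close>, all of which evaluate to zero.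
\<close>

lemma E_power_mult_falling_singleton:
  assumes "is_singleton_umbra E \<chi>"
  shows "E (umbra \<chi> ^ Suc r * falling (umbra \<chi>) (Suc m)) = 0"
proof (induction m arbitrary: r)
  case 0
  then show ?case
    using assms by (simp add: is_singleton_umbra_def falling_def flip: power_Suc power_Suc2)
next
  case (Suc m)
  have "(umbra \<chi> ^ Suc r * falling (umbra \<chi>) (Suc (Suc m)) :: ('u, 'k) umbral_poly) =
      umbra \<chi> ^ Suc (Suc r) * falling (umbra \<chi>) (Suc m) -
      of_nat (Suc m) * (umbra \<chi> ^ Suc r * falling (umbra \<chi>) (Suc m))"
    by (simp add: falling_def algebra_simps)
  then show ?case
    by (simp only: E_diff_of_nat Suc) simp
qed

text \<open>
  In \<open>(\<chi>)\<^sub>m\<^sub>+\<^sub>1 = \<chi> (\<chi>)\<^sub>m - m (\<chi>)\<^sub>m\<close> the first term evaluates to zero. Thus \<open>E[(\<chi>)\<^sub>m]\<close> satisfies the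
  recurrence required of the weights in \<open>sum_partitions_block_sums_eq_injection_sum\<close>.
\<close>

lemma E_falling_singleton_Suc:
  assumes "is_singleton_umbra E \<chi>" "1 \<le> m"
  shows "E (falling (umbra \<chi>) (Suc m)) = - of_nat m * E (falling (umbra \<chi>) m)"
proof -
  obtain m' where m: "m = Suc m'"
    using assms(2) by (cases m) auto
  have "(falling (umbra \<chi>) (Suc m) :: ('u, 'k) umbral_poly) =
      umbra \<chi> ^ Suc 0 * falling (umbra \<chi>) m - of_nat m * falling (umbra \<chi>) m"
    by (simp add: falling_def algebra_simps)
  then show ?thesis
    using E_power_mult_falling_singleton[OF assms(1), of 0 m']
    by (simp only: E_diff_of_nat m) (simp add: algebra_simps)
qed

lemma E_falling_singleton_1:
  assumes "is_singleton_umbra E \<chi>"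
  shows "E (falling (umbra \<chi>) 1) = 1"
  using assms by (simp add: falling_def is_singleton_umbra_def)

text \<open>
  As \<open>\<chi>\<close> has vanishing moments beyond the first, the only partition contributing to
  the dot product is the one all of whose parts are \<open>1\<close>, and its coefficient is \<open>k! / k! = 1\<close>.
\<close>

lemma E_chi_dot_chi_power:
  assumes "is_singleton_umbra E \<chi>" "is_dot_product E \<chi> \<chi> \<delta>"
  shows "E (umbra \<delta> ^ k) = E (falling (umbra \<chi>) k)"
proof -
  define a where "a j = E (umbra \<chi> ^ j)" for j
  have a: "a 1 = 1" "\<And>j. 2 \<le> j \<Longrightarrow> a j = 0"
    using assms(1) by (auto simp: a_def is_singleton_umbra_def)
  have ones: "replicate_mset k 1 \<in> integer_partitions k"
    by (simp add: integer_partitions_def)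
  have vanish: "(\<Prod>j\<in>set_mset l. a j ^ count l j) = 0"
    if l: "l \<in> integer_partitions k - {replicate_mset k 1}" for l
  proof -
    have "\<exists>j\<in>#l. j \<noteq> 1"
    proof (rule ccontr)
      assume "\<not> ?thesis"
      then have "l = replicate_mset (size l) 1"
        by (metis set_mset_subset_singletonD singletonI subsetI)
      moreover from this have "\<Sum>\<^sub># l = size l"
        by (metis mult.right_neutral sum_mset_replicate_mset of_nat_id mult_of_nat_commute)
      ultimately show False
        using l by (auto simp: integer_partitions_def)
    qed
    then obtain j where j: "j \<in># l" "j \<noteq> 1" by blast
    then have "2 \<le> j"
      using l by (cases j) (auto simp: integer_partitions_def)
    then have "a j ^ count l j = 0"
      using a(2) j(1) by (simp add: power_0_left)
    then show ?thesis
      using j(1) by (meson finite_set_mset prod_zero)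
  qed
  have "E (umbra \<delta> ^ k) = (\<Sum>l\<in>integer_partitions k. E (falling (umbra \<chi>) (size l)) * d_coeff l *
           (\<Prod>j\<in>set_mset l. a j ^ count l j))"
    using assms(2) by (simp add: is_dot_product_def a_def)
  also have "\<dots> = (\<Sum>l\<in>{replicate_mset k 1}. E (falling (umbra \<chi>) (size l)) * d_coeff l *
           (\<Prod>j\<in>set_mset l. a j ^ count l j))"
    using ones vanish by (intro sum.mono_neutral_right finite_integer_partitions) auto
  also have "\<dots> = E (falling (umbra \<chi>) k)"
    using a(1) by (cases k) (simp_all add: d_coeff_def del: fact_Suc)
  finally show ?thesis .
qed

section \<open>Evaluation of the inner sum\<close>

text \<open>
  An injection picks distinct copies of \<open>x\<close>, so all its terms have the same evaluation, and the
  falling factorial counts the injections. The bound on \<open>card K\<close> makes the truncated subtraction in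
  that count agree with subtraction in the field.
\<close>

lemma E_injection_sum_copies:
  assumes "uncorrelated_copies E x V \<beta>" "finite V" "finite K" "card K \<le> card V"
  shows "E (injection_sum (\<lambda>j v. umbra (\<beta> v) ^ e j) K V) =
    falling (of_nat (card V)) (card K) * (\<Prod>j\<in>K. E (umbra x ^ e j))"
proof -
  have "E (injection_sum (\<lambda>j v. umbra (\<beta> v) ^ e j) K V) =
      of_nat (card {f \<in> K \<rightarrow>\<^sub>E V. inj_on f K}) * (\<Prod>j\<in>K. E (umbra x ^ e j))"
    unfolding injection_sum_def E_sum
    using E_prod_uncorrelated_copies[OF assms(3) _ _ assms(1)]
    by (subst sum.cong[OF refl, of _ _ "\<lambda>_. \<Prod>j\<in>K. E (umbra x ^ e j)"]) (auto simp: PiE_def)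
  moreover have "(of_nat (card {f \<in> K \<rightarrow>\<^sub>E V. inj_on f K}) :: 'k) = falling (of_nat (card V)) (card K)"
    using assms(2-4)
    by (auto simp: card_inj_on_subset_funcset falling_def of_nat_diff lessThan_atLeast0 intro!: prod.cong)
  ultimately show ?thesis by simp
qed

end

lemma falling_of_nat_nonzero: "k \<le> n \<Longrightarrow> falling (of_nat n :: 'k::field_char_0) k \<noteq> 0"
  by (auto simp: falling_def)

text \<open>
  This lifts an enumeration of \<open>P\<^sub>\<lambda>\<close>, whose elements are polynomials, to one of the parts of \<open>\<lambda>\<close>.
\<close>

lemma enumerates_image_mset:
  assumes "enumerates s (image_mset h l)" "inj h"
  obtains e where "\<And>j. j \<in> {1..size l} \<Longrightarrow> s j = h (e j)" "image_mset e (mset_set {1..size l}) = l"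
proof -
  define e where "e j = inv h (s j)" for j
  have im: "image_mset s (mset_set {1..size l}) = image_mset h l"
    using assms(1) by (simp add: enumerates_def)
  have "s j \<in> range h" if "j \<in> {1..size l}" for j
  proof -
    have "s j \<in># image_mset s (mset_set {1..size l})"
      using that by simp
    then show ?thesis
      unfolding im by auto
  qed
  then have "s j = h (e j)" if "j \<in> {1..size l}" for j
    using that by (simp add: e_def f_inv_into_f)
  moreover have "image_mset e (mset_set {1..size l}) = l"
  proof -
    have "image_mset e (mset_set {1..size l}) = image_mset (inv h) (image_mset s (mset_set {1..size l}))"
      by (simp add: e_def[abs_def] multiset.map_comp comp_def)
    also have "\<dots> = l"
      unfolding im using assms(2) by (simp add: multiset.map_comp)
    finally show ?thesis .
  qed
  ultimately show ?thesis
    using that by blast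
qed

lemma power_sum_subdivision_eq_block_sums:
  assumes "finite K" "partition_on K \<pi>" "\<And>j. j \<in> K \<Longrightarrow> s j = umbra \<alpha> ^ e j"
  shows "power_sum_subdivision \<alpha> \<alpha>s n (subdivision s \<pi>) =
    (\<Prod>B\<in>\<pi>. block_sum (\<lambda>j v. umbra (\<alpha>s v) ^ e j) {1..n} B)"
proof -
  have "power_sum \<alpha> \<alpha>s n (\<Prod>j\<in>B. s j) = block_sum (\<lambda>j v. umbra (\<alpha>s v) ^ e j) {1..n} B"
    if "B \<in> \<pi>" for B
  proof -
    have "(\<Prod>j\<in>B. s j) = (\<Prod>j\<in>B. umbra \<alpha> ^ e j)"
      using assms(2,3) that by (intro prod.cong) (auto simp: partition_on_def)
    then show ?thesis
      by (simp add: block_sum_def power_sum_power flip: power_sum)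
  qed
  then have "(\<Prod>B\<in>\<pi>. power_sum \<alpha> \<alpha>s n (\<Prod>j\<in>B. s j)) =
      (\<Prod>B\<in>\<pi>. block_sum (\<lambda>j v. umbra (\<alpha>s v) ^ e j) {1..n} B)"
    by (rule prod.cong[OF refl])
  then show ?thesis
    by (simp add: power_sum_subdivision_def subdivision_def prod_unfold_prod_mset
        multiset.map_comp comp_def)
qed

text \<open>
  Replacing every \<open>(\<chi>.\<chi>)\<^sup>.\<^sup>\<pi>\<close> by its evaluation, a scalar, preserves the evaluation of the sum, since
  it is uncorrelated to the power sums. After this replacement the sum is, already as a
  polynomial, a sum over injections.
\<close>

lemma (in umbral_calculus) E_sum_dot_powers_power_sums:
  assumes \<chi>: "is_singleton_umbra E \<chi>" "is_dot_product E \<chi> \<chi> \<delta>"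
    and copies: "uncorrelated_copies E \<alpha> {1..n} \<alpha>s"
    and enum: "enumerates s (P_multiset \<alpha> l)" and le: "size l \<le> n"
    and pow: "\<And>\<pi>. partition_on {1..size l} \<pi> \<Longrightarrow> is_dot_power E \<delta> \<pi> (q \<pi>)"
    and uncor: "\<And>\<pi>. partition_on {1..size l} \<pi> \<Longrightarrow>
      uncorrelated (q \<pi>) (power_sum_subdivision \<alpha> \<alpha>s n (subdivision s \<pi>))"
  shows "E (\<Sum>\<pi> | partition_on {1..size l} \<pi>.
      q \<pi> * power_sum_subdivision \<alpha> \<alpha>s n (subdivision s \<pi>)) =
    falling (of_nat n) (size l) * (\<Prod>j\<in>set_mset l. E (umbra \<alpha> ^ j) ^ count l j)"
proof -
  define K where "K = {1..size l}"
  define w where "w m = E (umbra \<delta> ^ m)" for m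
  have w_1: "w 1 = 1" and w_Suc: "\<And>m. 1 \<le> m \<Longrightarrow> w (Suc m) = - of_nat m * w m"
    unfolding w_def E_chi_dot_chi_power[OF \<chi>]
    using E_falling_singleton_1[OF \<chi>(1)] E_falling_singleton_Suc[OF \<chi>(1)] by auto
  have "inj (\<lambda>j. umbra \<alpha> ^ j :: ('u, 'k) umbral_poly)"
    by (rule injI) (simp add: umbra_power_inject)
  then obtain e where s: "\<And>j. j \<in> K \<Longrightarrow> s j = umbra \<alpha> ^ e j"
    and e: "image_mset e (mset_set K) = l"
    using enumerates_image_mset[OF enum[unfolded P_multiset_def]] unfolding K_def by metis
  define x :: "nat \<Rightarrow> nat \<Rightarrow> ('u, 'k) umbral_poly" where "x j v = umbra (\<alpha>s v) ^ e j" for j v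
  have pss: "power_sum_subdivision \<alpha> \<alpha>s n (subdivision s \<pi>) = (\<Prod>B\<in>\<pi>. block_sum x {1..n} B)"
    if "partition_on K \<pi>" for \<pi>
    unfolding x_def using that s by (intro power_sum_subdivision_eq_block_sums) (auto simp: K_def)
  have "E (q \<pi> * power_sum_subdivision \<alpha> \<alpha>s n (subdivision s \<pi>)) =
      E (\<Prod>B\<in>\<pi>. scalar (w (card B)) * block_sum x {1..n} B)" if \<pi>: "partition_on K \<pi>" for \<pi>
  proof -
    have "finite \<pi>"
      using finite_elements[OF _ \<pi>] by (simp add: K_def)
    then have "E (q \<pi>) = (\<Prod>B\<in>\<pi>. w (card B))"
      unfolding w_def using pow \<pi> by (intro E_dot_power) (auto simp: K_def)
    then have "E (q \<pi> * power_sum_subdivision \<alpha> \<alpha>s n (subdivision s \<pi>)) =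
        (\<Prod>B\<in>\<pi>. w (card B)) * E (\<Prod>B\<in>\<pi>. block_sum x {1..n} B)"
      using E_mult_uncorrelated uncor \<pi> by (simp add: K_def pss)
    also have "\<dots> = E (\<Prod>B\<in>\<pi>. scalar (w (card B)) * block_sum x {1..n} B)"
      by (simp add: prod.distrib E_scalar flip: scalar_prod)
    finally show ?thesis .
  qed
  then have "E (\<Sum>\<pi> | partition_on K \<pi>. q \<pi> * power_sum_subdivision \<alpha> \<alpha>s n (subdivision s \<pi>)) =
      E (\<Sum>\<pi> | partition_on K \<pi>. \<Prod>B\<in>\<pi>. scalar (w (card B)) * block_sum x {1..n} B)"
    by (simp add: E_sum)
  also have "(\<Sum>\<pi> | partition_on K \<pi>. \<Prod>B\<in>\<pi>. scalar (w (card B)) * block_sum x {1..n} B) =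
      injection_sum x K {1..n}"
    by (rule sum_partitions_block_sums_eq_injection_sum)
      (simp_all add: K_def w_1[simplified] w_Suc scalar_one scalar_mult scalar_uminus scalar_of_nat)
  also have "E \<dots> = falling (of_nat n) (size l) * (\<Prod>j\<in>K. E (umbra \<alpha> ^ e j))"
    unfolding x_def using E_injection_sum_copies[OF copies, of K e] le by (simp add: K_def)
  also have "(\<Prod>j\<in>K. E (umbra \<alpha> ^ e j)) = (\<Prod>j\<in>#l. E (umbra \<alpha> ^ j))"
    by (subst e[symmetric]) (simp add: prod_unfold_prod_mset multiset.map_comp comp_def)
  also have "\<dots> = (\<Prod>j\<in>set_mset l. E (umbra \<alpha> ^ j) ^ count l j)"
    by (rule image_prod_mset_multiplicity)
  finally show ?thesis
    by (simp add: K_def)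
qed

section \<open>Cumulants in terms of power sums\<close>

lemma size_integer_partition_le: "l \<in> integer_partitions i \<Longrightarrow> size l \<le> i"
proof -
  have "0 \<notin># l \<Longrightarrow> size l \<le> \<Sum>\<^sub># l" for l :: "nat multiset"
    by (induction l) auto
  then show "l \<in> integer_partitions i \<Longrightarrow> size l \<le> i"
    by (auto simp: integer_partitions_def)
qed

theorem theorem4p1:
  fixes E :: "('u, 'k::field_char_0) umbral_poly \<Rightarrow> 'k"
    and \<alpha> \<chi> chi_dot_alpha chi_dot_chi :: 'u
    and \<alpha>s :: "nat \<Rightarrow> 'u"
    and s :: "nat multiset \<Rightarrow> nat \<Rightarrow> ('u, 'k) umbral_poly"
    and dot_pow :: "nat multiset \<Rightarrow> nat set set \<Rightarrow> ('u, 'k) umbral_poly"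
    and n i :: nat
  assumes "umbral_calculus E"
    and "0 < n" and "0 < i" and "i \<le> n"
    and "is_singleton_umbra E \<chi>"
    and "is_dot_product E \<chi> \<alpha> chi_dot_alpha"
    and "is_dot_product E \<chi> \<chi> chi_dot_chi"
    and "uncorrelated_copies E \<alpha> {1..n} \<alpha>s"
    and "\<And>l. l \<in> integer_partitions i \<Longrightarrow> enumerates (s l) (P_multiset \<alpha> l)"
    and "\<And>l \<pi>. l \<in> integer_partitions i \<Longrightarrow> partition_on {1..size l} \<pi> \<Longrightarrow>
           is_dot_power E chi_dot_chi \<pi> (dot_pow l \<pi>)"
    and "\<And>l \<pi>. l \<in> integer_partitions i \<Longrightarrow> partition_on {1..size l} \<pi> \<Longrightarrow>
           uncorrelated (umbra chi_dot_chi ^ size l) (dot_pow l \<pi>)"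
    and "\<And>l \<pi>. l \<in> integer_partitions i \<Longrightarrow> partition_on {1..size l} \<pi> \<Longrightarrow>
           uncorrelated (umbra chi_dot_chi ^ size l :: ('u, 'k) umbral_poly)
             (power_sum_subdivision \<alpha> \<alpha>s n (subdivision (s l) \<pi>))"
    and "\<And>l \<pi>. l \<in> integer_partitions i \<Longrightarrow> partition_on {1..size l} \<pi> \<Longrightarrow>
           uncorrelated (dot_pow l \<pi>) (power_sum_subdivision \<alpha> \<alpha>s n (subdivision (s l) \<pi>))"
  shows "umbral_equiv E (umbra chi_dot_alpha ^ i)
           (\<Sum>l\<in>integer_partitions i.
              umbra chi_dot_chi ^ size l * scalar (1 / falling (of_nat n) (size l)) *
              scalar (d_coeff l) *
              (\<Sum>\<pi> | partition_on {1..size l} \<pi>.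
                 dot_pow l \<pi> * power_sum_subdivision \<alpha> \<alpha>s n (subdivision (s l) \<pi>)))"
proof -
  interpret umbral_calculus E by fact
  let ?S = "\<lambda>l. \<Sum>\<pi> | partition_on {1..size l} \<pi>.
    dot_pow l \<pi> * power_sum_subdivision \<alpha> \<alpha>s n (subdivision (s l) \<pi>)"
  have "E (umbra chi_dot_chi ^ size l * scalar (1 / falling (of_nat n) (size l)) *
        scalar (d_coeff l) * ?S l) =
      E (falling (umbra \<chi>) (size l)) * d_coeff l *
        (\<Prod>j\<in>set_mset l. E (umbra \<alpha> ^ j) ^ count l j)"
    if l: "l \<in> integer_partitions i" for l
  proof -
    have le: "size l \<le> n"
      using size_integer_partition_le[OF l] \<open>i \<le> n\<close> by simp
    have "uncorrelated (umbra chi_dot_chi ^ size l) (?S l)"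
      using assms(11,12)[OF l] by (intro uncorrelated_sum uncorrelated_mult) auto
    then have "E (umbra chi_dot_chi ^ size l * ?S l) = E (falling (umbra \<chi>) (size l)) * E (?S l)"
      by (simp only: E_mult_uncorrelated E_chi_dot_chi_power[OF assms(5,7)])
    moreover have "umbra chi_dot_chi ^ size l * scalar (1 / falling (of_nat n) (size l)) *
        scalar (d_coeff l) * ?S l =
        scalar (1 / falling (of_nat n) (size l)) *
        (scalar (d_coeff l) * (umbra chi_dot_chi ^ size l * ?S l))"
      by (simp only: mult_ac)
    moreover have "E (?S l) = falling (of_nat n) (size l) *
        (\<Prod>j\<in>set_mset l. E (umbra \<alpha> ^ j) ^ count l j)"
      by (rule E_sum_dot_powers_power_sums[OF assms(5,7,8) assms(9)[OF l] le assms(10,13)[OF l]])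
    ultimately show ?thesis
      using falling_of_nat_nonzero[OF le, where 'k = 'k] by (simp only: E_scalar) simp
  qed
  then show ?thesis
    using assms(6) by (simp add: umbral_equiv_def is_dot_product_def E_sum)
qed

end
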